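(* Let $(X_n)_{n\ge1}$, $(Y_n)_{n\ge1}$, $f^\star$, $b$ be as in the adaptive logistic regression model described in the context. Fix $y>0$ and $\rho>0$, let $(\beta_n(\rho,y))_{n\ge1}$ be a concentration radius as defined in the context with associated event $\mathcal C$, let $\hat f_n$ be the logistic ridge regressor with regularisation $\rho$, and let $A^\star_n=A_n(f^\star)$, $\hat A_n=A_n(\hat f_n)$. Define $$u_n=\frac{\beta_n(\rho,y)}{\sqrt\rho}+b,\qquad \omega_n=u_n(6+2u_n^3)\sqrt\rho,\qquad \alpha_n=u_n(1+u_n).$$ Then, on the event $\mathcal C$, for all $n\ge1$, $$\max\left\{\|(A^\star_n+\rho I)^{1/2}(f^\star-\hat f_n)\|,\ \|(\hat A_n+\rho I)^{1/2}(f^\star-\hat f_n)\|\right\}\le\omega_n\qquad\text{and}\qquad \|f^\star-\hat f_n\|\le\alpha_n.$$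
   Context: Model. $\mathcal H$ is a real separable Hilbert space with closed unit ball $B$ and identity operator $I$; $(\Omega,\mathcal F,\mathbb P)$ is a probability space with filtration $(\mathcal F_n)_{n\ge0}$. Let $\mu(u)=1/(1+e^{-u})$ and $\mathrm V(u)=\mu(u)(1-\mu(u))$. The covariates $(X_n)_{n\ge1}$ are predictable ($X_n$ is $\mathcal F_{n-1}$-measurable) with values in a compact set $\mathcal X\subset B$; the responses $(Y_n)_{n\ge1}$ are adapted with values in $[0,1]$ (not necessarily Bernoulli) and satisfy $\mathbb E[Y_n\mid\mathcal F_{n-1}]=\mu(\langle f^\star,X_n\rangle)$ a.s. for a fixed $f^\star\in\mathcal H$ with $\|f^\star\|\le b$, where $b>0$ is known. Residual process. $\epsilon_j=Y_j-\mu(\langle f^\star,X_j\rangle)$, $M_n=\sum_{j=1}^n\epsilon_jX_j$, $Q_n=\sum_{j=1}^n\mathbb E[\epsilon_j^2\mid\mathcal F_{j-1}]\,X_j\otimes X_j$, where $x\otimes x$ is the operator $z\mapsto\langle x,z\rangle x$. Concentration radius. $\beta_n(\rho,y)\ge 0$ is any (possibly random) radius, nondecreasing in $n$, such that the event $\mathcal C=\bigcap_{n\ge1}\{\|(Q_n+\rho I)^{-1/2}M_n\|\le\beta_n(\rho,y)\}$ satisfies $\mathbb P[\mathcal C]\ge1-Ce^{-y}$ for some constant $C$. Logistic information and estimator. For $f\in\mathcal H$, $A_n(f)=\sum_{j=1}^n\mathrm V(\langle f,X_j\rangle)\,X_j\otimes X_j$. With $\ell(u,y)=-y\log\mu(u)-(1-y)\log(1-\mu(u))$,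 let $\mathcal L_n(f)=\sum_{i=1}^n\ell(\langle f,X_i\rangle,Y_i)+\frac\rho2\|f\|^2$ and $\hat f_n\in\arg\min_{f\in\mathcal H}\mathcal L_n(f)$. Inequalities that involve conditional expectations (through $Q_n$) are understood almost surely. *)

theory Defs
  imports "HOL-Probability.Probability"
begin

section \<open>Bounded operators on a Hilbert space\<close>

lift_definition tensor_op :: "'a::real_inner \<Rightarrow> 'a \<Rightarrow>\<^sub>L 'a" is "\<lambda>x z. (x \<bullet> z) *\<^sub>R x"
  by (intro bounded_linear_intros)

text \<open>Over the reals, self-adjointness does not follow from nonnegativity of the quadratic
  form, so it is required separately.\<close>

definition positive_op :: "('a::real_inner \<Rightarrow>\<^sub>L 'a) \<Rightarrow> bool" where
  "positive_op T \<longleftrightarrow> (\<forall>x z. T x \<bullet> z = x \<bullet> T z) \<and> (\<forall>x. 0 \<le> T x \<bullet> x)"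

text \<open>Meaningful for positive \<open>T\<close> on a complete space, where the positive square root exists and
  is unique.\<close>

definition sqrt_op :: "('a::real_inner \<Rightarrow>\<^sub>L 'a) \<Rightarrow> ('a \<Rightarrow>\<^sub>L 'a)" where
  "sqrt_op T = (THE S. positive_op S \<and> S o\<^sub>L S = T)"

text \<open>\<open>T\<close> to the power \<open>-1/2\<close>, as a function; meaningful for positive \<open>T\<close> with bijective
  square root, such as \<open>A + \<rho> I\<close> with \<open>A\<close> positive and \<open>\<rho> > 0\<close>.\<close>

definition inv_sqrt_op :: "('a::real_inner \<Rightarrow>\<^sub>L 'a) \<Rightarrow> 'a \<Rightarrow> 'a" where
  "inv_sqrt_op T = inv (blinfun_apply (sqrt_op T))"

definition regularised :: "('a::real_inner \<Rightarrow>\<^sub>L 'a) \<Rightarrow> real \<Rightarrow> ('a \<Rightarrow>\<^sub>L 'a)" where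
  "regularised T \<rho> = T + \<rho> *\<^sub>R id_blinfun"

section \<open>Adaptive logistic regression\<close>

definition logistic :: "real \<Rightarrow> real" where
  "logistic u = 1 / (1 + exp (- u))"

definition logistic_var :: "real \<Rightarrow> real" where
  "logistic_var u = logistic u * (1 - logistic u)"

definition logistic_loss :: "real \<Rightarrow> real \<Rightarrow> real" where
  "logistic_loss u y = - y * ln (logistic u) - (1 - y) * ln (1 - logistic u)"

text \<open>All processes indexed by \<open>n \<ge> 1\<close> are functions on \<open>nat\<close> whose value at \<open>0\<close> is
  unconstrained and never used.\<close>

locale adaptive_logistic_model = prob_space M + filtration "space M" F
  for M :: "'w measure" and F :: "nat \<Rightarrow> 'w measure" +
  fixes \<X> :: "'a::{real_inner, banach, second_countable_topology} set"
    and X :: "nat \<Rightarrow> 'w \<Rightarrow> 'a"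
    and Y :: "nat \<Rightarrow> 'w \<Rightarrow> real"
    and fstar :: 'a
    and b :: real
  assumes filtration_subalgebra: "\<And>n. subalgebra M (F n)"
    and covariate_set_compact: "compact \<X>"
    and covariate_set_subset: "\<X> \<subseteq> cball 0 1"
    and X_predictable: "\<And>n. n \<ge> 1 \<Longrightarrow> X n \<in> borel_measurable (F (n - 1))"
    and X_range: "\<And>n \<omega>. n \<ge> 1 \<Longrightarrow> \<omega> \<in> space M \<Longrightarrow> X n \<omega> \<in> \<X>"
    and Y_adapted: "\<And>n. n \<ge> 1 \<Longrightarrow> Y n \<in> borel_measurable (F n)"
    and Y_range: "\<And>n \<omega>. n \<ge> 1 \<Longrightarrow> \<omega> \<in> space M \<Longrightarrow> Y n \<omega> \<in> {0..1}"
    and Y_cond_mean: "\<And>n. n \<ge> 1 \<Longrightarrow>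
          AE \<omega> in M. real_cond_exp M (F (n - 1)) (Y n) \<omega> = logistic (fstar \<bullet> X n \<omega>)"
    and b_pos: "0 < b"
    and fstar_bound: "norm fstar \<le> b"

definition residual ::
  "(nat \<Rightarrow> 'w \<Rightarrow> 'a::real_inner) \<Rightarrow> (nat \<Rightarrow> 'w \<Rightarrow> real) \<Rightarrow> 'a \<Rightarrow> nat \<Rightarrow> 'w \<Rightarrow> real" where
  "residual X Y fstar j \<omega> = Y j \<omega> - logistic (fstar \<bullet> X j \<omega>)"

definition residual_sum ::
  "(nat \<Rightarrow> 'w \<Rightarrow> 'a::real_inner) \<Rightarrow> (nat \<Rightarrow> 'w \<Rightarrow> real) \<Rightarrow> 'a \<Rightarrow> nat \<Rightarrow> 'w \<Rightarrow> 'a" where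
  "residual_sum X Y fstar n \<omega> = (\<Sum>j=1..n. residual X Y fstar j \<omega> *\<^sub>R X j \<omega>)"

text \<open>The weights are nonnegative, and hence the operator is positive, only almost surely.\<close>

definition cond_covariance ::
  "'w measure \<Rightarrow> (nat \<Rightarrow> 'w measure) \<Rightarrow> (nat \<Rightarrow> 'w \<Rightarrow> 'a::real_inner) \<Rightarrow> (nat \<Rightarrow> 'w \<Rightarrow> real)
    \<Rightarrow> 'a \<Rightarrow> nat \<Rightarrow> 'w \<Rightarrow> ('a \<Rightarrow>\<^sub>L 'a)" where
  "cond_covariance M F X Y fstar n \<omega> =
     (\<Sum>j=1..n. real_cond_exp M (F (j - 1)) (\<lambda>\<omega>'. (residual X Y fstar j \<omega>')\<^sup>2) \<omega>
        *\<^sub>R tensor_op (X j \<omega>))"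

definition logistic_info ::
  "(nat \<Rightarrow> 'w \<Rightarrow> 'a::real_inner) \<Rightarrow> nat \<Rightarrow> 'a \<Rightarrow> 'w \<Rightarrow> ('a \<Rightarrow>\<^sub>L 'a)" where
  "logistic_info X n f \<omega> = (\<Sum>j=1..n. logistic_var (f \<bullet> X j \<omega>) *\<^sub>R tensor_op (X j \<omega>))"

definition regularised_loss ::
  "(nat \<Rightarrow> 'w \<Rightarrow> 'a::real_inner) \<Rightarrow> (nat \<Rightarrow> 'w \<Rightarrow> real) \<Rightarrow> real \<Rightarrow> nat \<Rightarrow> 'w \<Rightarrow> 'a \<Rightarrow> real" where
  "regularised_loss X Y \<rho> n \<omega> f =
     (\<Sum>i=1..n. logistic_loss (f \<bullet> X i \<omega>) (Y i \<omega>)) + \<rho> / 2 * (norm f)\<^sup>2"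

definition concentration_event ::
  "'w measure \<Rightarrow> (nat \<Rightarrow> 'w measure) \<Rightarrow> (nat \<Rightarrow> 'w \<Rightarrow> 'a::real_inner) \<Rightarrow> (nat \<Rightarrow> 'w \<Rightarrow> real)
    \<Rightarrow> 'a \<Rightarrow> (nat \<Rightarrow> real \<Rightarrow> real \<Rightarrow> 'w \<Rightarrow> real) \<Rightarrow> real \<Rightarrow> real \<Rightarrow> 'w set" where
  "concentration_event M F X Y fstar \<beta> \<rho> y =
     {\<omega> \<in> space M. \<forall>n\<ge>1.
        norm (inv_sqrt_op (regularised (cond_covariance M F X Y fstar n \<omega>) \<rho>)
               (residual_sum X Y fstar n \<omega>)) \<le> \<beta> n \<rho> y \<omega>}"

definition concentration_radius ::
  "'w measure \<Rightarrow> (nat \<Rightarrow> 'w measure) \<Rightarrow> (nat \<Rightarrow> 'w \<Rightarrow> 'a::real_inner) \<Rightarrow> (nat \<Rightarrow> 'w \<Rightarrow> real)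
    \<Rightarrow> 'a \<Rightarrow> real \<Rightarrow> (nat \<Rightarrow> real \<Rightarrow> real \<Rightarrow> 'w \<Rightarrow> real) \<Rightarrow> real \<Rightarrow> real \<Rightarrow> bool" where
  "concentration_radius M F X Y fstar K \<beta> \<rho> y \<longleftrightarrow>
     (\<forall>n\<ge>1. \<beta> n \<rho> y \<in> borel_measurable M) \<and>
     (\<forall>n\<ge>1. \<forall>\<omega>\<in>space M. 0 \<le> \<beta> n \<rho> y \<omega>) \<and>
     (\<forall>m\<ge>1. \<forall>n\<ge>m. \<forall>\<omega>\<in>space M. \<beta> m \<rho> y \<omega> \<le> \<beta> n \<rho> y \<omega>) \<and>
     concentration_event M F X Y fstar \<beta> \<rho> y \<in> sets M \<and>
     measure M (concentration_event M F X Y fstar \<beta> \<rho> y) \<ge> 1 - K * exp (- y)"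

end

theory Submission
  imports Defs
begin

text \<open>Let \<open>h = f\<^sup>\<star> - f\<close> be the error, \<open>N = \<parallel>h\<parallel>\<close> and \<open>a = \<parallel>(A\<^sup>\<star> + \<rho> I)\<^bsup>1/2\<^esup> h\<parallel>\<close>. Pairing the first-order
  condition for the minimiser \<open>f\<close> with \<open>h\<close> expresses
  \<open>G + \<rho> N\<^sup>2\<close>, where \<open>G = \<Sum> (\<mu>\<langle>f\<^sup>\<star>, X\<rangle> - \<mu>\<langle>f, X\<rangle>) \<langle>h, X\<rangle>\<close>, as \<open>\<rho> \<langle>f\<^sup>\<star>, h\<rangle> - \<langle>M, h\<rangle>\<close>. Responses in
  \<open>[0, 1]\<close> have conditional variance at most \<open>V\<langle>f\<^sup>\<star>, X\<rangle>\<close>, so \<open>Q \<le> A\<^sup>\<star>\<close> and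
  the right-hand side is at most \<open>u \<surd>\<rho> a\<close>. Self-concordance gives \<open>a\<^sup>2 \<le> (1 + N) G + \<rho> N\<^sup>2\<close>,
  whence, with \<open>\<xi> = a / \<surd>\<rho> \<ge> N\<close>, the inequality \<open>\<xi>\<^sup>2 + N\<^sup>3 \<le> (1 + N) \<xi> u\<close>. The cubic term,
  which comes from the part of the ridge that self-concordance does not lose, is what bounds \<open>N\<close>
  when \<open>u \<ge> 1\<close>.\<close>

section \<open>Square roots of coercive operators\<close>

interpretation blinfun_compose: bounded_bilinear "(o\<^sub>L)"
  by (rule bounded_bilinear_blinfun_compose)

lemma blinfun_compose_assoc: "(A o\<^sub>L B) o\<^sub>L C = A o\<^sub>L (B o\<^sub>L C)"
  by (rule blinfun_eqI) simp

text \<open>The equation says \<open>(I - W)\<^sup>2 = I - R\<close>; it is solved by the contraction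
  \<open>W \<mapsto> (R + W\<^sup>2) / 2\<close>. The commutation property is what makes the square root unique.\<close>

lemma ex_contraction_quadratic_fixpoint:
  fixes R :: "'a::{real_inner, banach} \<Rightarrow>\<^sub>L 'a"
  assumes q: "norm R \<le> q" "q < 1" and R: "\<And>x z. R x \<bullet> z = x \<bullet> R z"
  obtains W where "norm W \<le> q" "2 *\<^sub>R W = R + (W o\<^sub>L W)" "\<And>x z. W x \<bullet> z = x \<bullet> W z"
    "\<And>V. V o\<^sub>L R = R o\<^sub>L V \<Longrightarrow> V o\<^sub>L W = W o\<^sub>L V"
proof -
  define \<Phi> where "\<Phi> W = (1/2) *\<^sub>R (R + (W o\<^sub>L W))" for W
  \<comment> \<open>The invariants are closed conditions preserved by \<open>\<Phi>\<close>, so the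
    fixed point inherits symmetry and commutation along with the norm bound. The ball is stable
    because (q + q^2)/2 \<le> q, and on it \<open>\<Phi>\<close> contracts with factor q.\<close>
  define D where "D = {W. norm W \<le> q \<and> (\<forall>x z. blinfun_apply W x \<bullet> z = x \<bullet> blinfun_apply W z) \<and>
    (\<forall>V. V o\<^sub>L R = R o\<^sub>L V \<longrightarrow> V o\<^sub>L W = W o\<^sub>L V)}"
  have q0: "0 \<le> q"
    using q(1) norm_ge_zero order_trans by blast
  have "closed D"
    unfolding D_def
    by (intro closed_Collect_conj closed_Collect_all closed_Collect_imp closed_Collect_le
        closed_Collect_eq continuous_intros) auto
  then have "\<exists>!W\<in>D. \<Phi> W = W" if "D \<noteq> {}" "\<Phi> ` D \<subseteq> D"
      "\<And>W V. W \<in> D \<Longrightarrow> V \<in> D \<Longrightarrow> dist (\<Phi> W) (\<Phi> V) \<le> q * dist W V"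
    using that q0 q(2) by (intro Banach_fix) (auto simp: complete_eq_closed)
  moreover have "D \<noteq> {}"
  proof -
    have "0 \<in> D" using q0 by (simp add: D_def blinfun_compose.zero_left blinfun_compose.zero_right)
    then show ?thesis by blast
  qed
  moreover have "\<Phi> ` D \<subseteq> D"
  proof
    fix U assume "U \<in> \<Phi> ` D"
    then obtain W where W: "W \<in> D" and U: "U = \<Phi> W" by blast
    have nW: "norm W \<le> q" using W unfolding D_def by blast
    have "norm (W o\<^sub>L W) \<le> norm W * norm W" by (rule norm_blinfun_compose)
    also have "\<dots> \<le> q * 1"
      using nW q q0 by (intro mult_mono) auto
    finally have "norm (R + (W o\<^sub>L W)) \<le> q + q"
      using q(1) norm_triangle_ineq[of R "W o\<^sub>L W"] by linarith
    then have "norm U \<le> q" by (simp add: U \<Phi>_def)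
    moreover have "U x \<bullet> z = x \<bullet> U z" for x z
    proof -
      have "W x \<bullet> z = x \<bullet> W z" for x z using W unfolding D_def by blast
      then show ?thesis using R by (simp add: U \<Phi>_def blinfun.bilinear_simps inner_simps)
    qed
    moreover have "V o\<^sub>L U = U o\<^sub>L V" if V: "V o\<^sub>L R = R o\<^sub>L V" for V
    proof -
      have VW: "V o\<^sub>L W = W o\<^sub>L V" using W V unfolding D_def by blast
      have "V o\<^sub>L (W o\<^sub>L W) = (V o\<^sub>L W) o\<^sub>L W" by (simp only: blinfun_compose_assoc)
      also have "\<dots> = W o\<^sub>L (V o\<^sub>L W)" by (simp only: VW blinfun_compose_assoc)
      also have "\<dots> = (W o\<^sub>L W) o\<^sub>L V" by (simp only: VW blinfun_compose_assoc)
      finally have "V o\<^sub>L (W o\<^sub>L W) = (W o\<^sub>L W) o\<^sub>L V" .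
      then show ?thesis
        by (simp add: U \<Phi>_def V blinfun_compose.scaleR_left blinfun_compose.scaleR_right
            blinfun_compose.add_left blinfun_compose.add_right)
    qed
    ultimately show "U \<in> D" unfolding D_def by blast
  qed
  moreover have "dist (\<Phi> W) (\<Phi> V) \<le> q * dist W V" if "W \<in> D" "V \<in> D" for W V
  proof -
    from that have n: "norm W \<le> q" "norm V \<le> q" unfolding D_def by blast+
    have "(W o\<^sub>L W) - (V o\<^sub>L V) = (W o\<^sub>L (W - V)) + ((W - V) o\<^sub>L V)"
      by (simp add: blinfun_compose.diff_left blinfun_compose.diff_right)
    also have "norm \<dots> \<le> norm (W o\<^sub>L (W - V)) + norm ((W - V) o\<^sub>L V)"
      by (rule norm_triangle_ineq)
    also have "\<dots> \<le> norm W * norm (W - V) + norm (W - V) * norm V"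
      by (intro add_mono norm_blinfun_compose)
    also have "\<dots> \<le> q * norm (W - V) + norm (W - V) * q"
      using n by (intro add_mono mult_right_mono mult_left_mono) auto
    finally have "norm ((W o\<^sub>L W) - (V o\<^sub>L V)) \<le> 2 * (q * norm (W - V))" by simp
    moreover have "\<Phi> W - \<Phi> V = (1/2) *\<^sub>R ((W o\<^sub>L W) - (V o\<^sub>L V))"
      by (simp add: \<Phi>_def scaleR_diff_right scaleR_add_right)
    ultimately show "dist (\<Phi> W) (\<Phi> V) \<le> q * dist W V"
      by (simp add: dist_norm)
  qed
  ultimately have "\<exists>!W\<in>D. \<Phi> W = W" by blast
  then obtain W where W: "W \<in> D" "\<Phi> W = W" by blast
  have "2 *\<^sub>R W = 2 *\<^sub>R \<Phi> W" using W(2) by simp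
  also have "\<dots> = R + (W o\<^sub>L W)" by (simp add: \<Phi>_def)
  finally have *: "2 *\<^sub>R W = R + (W o\<^sub>L W)" .
  show thesis
    using W(1) by (intro that[OF _ *]) (unfold D_def, blast+)
qed

text \<open>With T = c (I - R) and R a strict contraction, the root is sqrt c (I - W), where (I -
  W)^2 = I - R. Coercivity of the root and its commutation with everything that commutes with T are
  recorded because the uniqueness argument rests on them.\<close>

lemma coercive_square_root:
  fixes T :: "'a::{real_inner, banach} \<Rightarrow>\<^sub>L 'a"
  assumes T: "\<And>x z. T x \<bullet> z = x \<bullet> T z" and \<rho>: "0 < \<rho>"
    and coercive: "\<And>x. \<rho> * (norm x)\<^sup>2 \<le> T x \<bullet> x"
  obtains S \<delta> where "positive_op S" "S o\<^sub>L S = T" "surj S" "0 < \<delta>"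
    "\<And>x. \<delta> * (norm x)\<^sup>2 \<le> S x \<bullet> x"
    "\<And>V. V o\<^sub>L T = T o\<^sub>L V \<Longrightarrow> V o\<^sub>L S = S o\<^sub>L V"
proof -
  \<comment> \<open>For this \<open>c\<close>, \<open>\<parallel>x - T x / c\<parallel>\<^sup>2 \<le> (1 - 2 \<rho> / c + \<parallel>T\<parallel>\<^sup>2 / c\<^sup>2) \<parallel>x\<parallel>\<^sup>2 \<le> (1 - \<rho> / c) \<parallel>x\<parallel>\<^sup>2\<close>.\<close>
  define c where "c = (norm T)\<^sup>2 / \<rho> + \<rho>"
  define R where "R = id_blinfun - (1/c) *\<^sub>R T"
  define q where "q = sqrt (1 - \<rho> / c)"
  have c: "\<rho> \<le> c" "0 < c" using \<rho> by (auto simp: c_def add_nonneg_pos)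
  have q: "0 \<le> q" "q < 1" "q\<^sup>2 = 1 - \<rho> / c"
    using c \<rho> by (auto simp: q_def)
  have "norm (R x) \<le> q * norm x" for x
  proof (rule power2_le_imp_le)
    have "(norm (T x))\<^sup>2 \<le> (norm T)\<^sup>2 * (norm x)\<^sup>2"
      using power_mono[OF norm_blinfun[of T x], of 2] by (simp add: power_mult_distrib)
    also have "\<dots> \<le> (\<rho> * c) * (norm x)\<^sup>2"
      using \<rho> by (intro mult_right_mono) (auto simp: c_def field_simps)
    finally have 1: "(norm (T x))\<^sup>2 / c\<^sup>2 \<le> \<rho> / c * (norm x)\<^sup>2"
      using c(2) by (simp add: field_simps power2_eq_square)
    have 2: "\<rho> / c * (norm x)\<^sup>2 \<le> T x \<bullet> x / c"
      using coercive[of x] c(2) by (simp add: divide_right_mono)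
    have "(norm (R x))\<^sup>2 = (norm x)\<^sup>2 - 2 * (T x \<bullet> x / c) + (norm (T x))\<^sup>2 / c\<^sup>2"
      unfolding power2_norm_eq_inner
      by (simp add: R_def blinfun.bilinear_simps inner_simps inner_commute power2_eq_square)
    also have "\<dots> \<le> (1 - \<rho> / c) * (norm x)\<^sup>2"
      using 1 2 by (simp add: left_diff_distrib)
    finally show "(norm (R x))\<^sup>2 \<le> (q * norm x)\<^sup>2"
      by (simp add: power_mult_distrib q)
  qed (use q in simp)
  then have nR: "norm R \<le> q" by (intro norm_blinfun_bound q)
  have "R x \<bullet> z = x \<bullet> R z" for x z
    unfolding R_def using T by (simp add: blinfun.bilinear_simps inner_simps)
  then obtain W where W: "norm W \<le> q" "2 *\<^sub>R W = R + (W o\<^sub>L W)" "\<And>x z. W x \<bullet> z = x \<bullet> W z"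
    and comm: "\<And>V. V o\<^sub>L R = R o\<^sub>L V \<Longrightarrow> V o\<^sub>L W = W o\<^sub>L V"
    by (rule ex_contraction_quadratic_fixpoint[OF nR q(2)]) (rule that)
  define S where "S = sqrt c *\<^sub>R (id_blinfun - W)"
  have Wx: "norm (W x) \<le> q * norm x" for x
    using W(1) by (metis mult_right_mono norm_blinfun norm_ge_zero order_trans)
  have coerS: "sqrt c * (1 - q) * (norm x)\<^sup>2 \<le> S x \<bullet> x" for x
  proof -
    have "W x \<bullet> x \<le> norm (W x) * norm x" by (rule norm_cauchy_schwarz)
    also have "\<dots> \<le> q * norm x * norm x" by (intro mult_right_mono Wx) simp
    finally have "(1 - q) * (norm x)\<^sup>2 \<le> x \<bullet> x - W x \<bullet> x"
      by (simp add: power2_norm_eq_inner[symmetric] left_diff_distrib power2_eq_square)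
    then have "sqrt c * ((1 - q) * (norm x)\<^sup>2) \<le> sqrt c * (x \<bullet> x - W x \<bullet> x)"
      using c by (intro mult_left_mono) auto
    then show ?thesis
      by (simp add: S_def blinfun.bilinear_simps inner_simps mult.assoc)
  qed
  have pos: "0 < sqrt c * (1 - q)" using c q by simp
  have "S o\<^sub>L S = T"
  proof (rule blinfun_eqI)
    fix x
    have "2 *\<^sub>R W x = R x + W (W x)"
      using arg_cong[OF W(2), of "\<lambda>A. blinfun_apply A x"] by (simp add: blinfun.bilinear_simps)
    then have eq: "W x + W x = R x + W (W x)" by (simp add: scaleR_2)
    have "(S o\<^sub>L S) x = c *\<^sub>R (x - (W x + W x) + W (W x))"
      using c by (simp add: S_def blinfun.bilinear_simps algebra_simps)
    also have "\<dots> = T x" unfolding eq using c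
      by (simp add: R_def blinfun.bilinear_simps)
    finally show "(S o\<^sub>L S) x = T x" .
  qed
  moreover have "positive_op S"
  proof -
    have "0 \<le> S x \<bullet> x" for x
      using coerS[of x] pos by (meson mult_nonneg_nonneg order_trans less_imp_le zero_le_power2)
    moreover have "S x \<bullet> z = x \<bullet> S z" for x z
      by (simp add: S_def blinfun.bilinear_simps inner_simps W(3))
    ultimately show ?thesis by (simp add: positive_op_def)
  qed
  moreover have "surj S"
  proof (rule surjI)
    fix y
    show "S (SOME x. S x = y) = y"
    proof (rule someI_ex)
      \<comment> \<open>Solving S x = y amounts to x = y / sqrt c + W x, a fixed-point equation for
        a contraction.\<close>
      let ?f = "\<lambda>x. (1 / sqrt c) *\<^sub>R y + W x"
      have "\<exists>!x. ?f x = x"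
      proof (rule banach_fix_type)
        show "\<forall>x z. dist (?f x) (?f z) \<le> q * dist x z"
          using Wx by (auto simp: dist_norm simp flip: blinfun.diff_right)
      qed (use q in auto)
      then obtain x where "(1 / sqrt c) *\<^sub>R y + W x = x" by blast
      then have "x - W x = (1 / sqrt c) *\<^sub>R y" by (metis add_diff_cancel_right')
      then have "S x = y" using c by (simp add: S_def blinfun.bilinear_simps)
      then show "\<exists>x. S x = y" ..
    qed
  qed
  moreover have "V o\<^sub>L S = S o\<^sub>L V" if V: "V o\<^sub>L T = T o\<^sub>L V" for V
  proof -
    have id: "V o\<^sub>L id_blinfun = V" "id_blinfun o\<^sub>L V = V"
      by (auto intro!: blinfun_eqI)
    have "V o\<^sub>L R = R o\<^sub>L V"
      using V by (simp add: R_def id blinfun_compose.diff_left blinfun_compose.diff_right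
          blinfun_compose.scaleR_left blinfun_compose.scaleR_right)
    then have "V o\<^sub>L W = W o\<^sub>L V" by (rule comm)
    then show ?thesis
      by (simp add: S_def id blinfun_compose.diff_left blinfun_compose.diff_right
          blinfun_compose.scaleR_left blinfun_compose.scaleR_right)
  qed
  ultimately show thesis using that pos coerS by blast
qed

text \<open>Uniqueness makes the definite description in \<open>sqrt_op\<close> meaningful: another
  positive root U commutes with T = U^2, hence with S, so (S + U)(U - S) = 0. Pairing with z = (U -
  S) x and using coercivity of S gives z = 0.\<close>

lemma sqrt_op_coercive:
  fixes T :: "'a::{real_inner, banach} \<Rightarrow>\<^sub>L 'a"
  assumes T: "\<And>x z. T x \<bullet> z = x \<bullet> T z" and \<rho>: "0 < \<rho>"
    and coercive: "\<And>x. \<rho> * (norm x)\<^sup>2 \<le> T x \<bullet> x"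
  shows "positive_op (sqrt_op T)" "sqrt_op T o\<^sub>L sqrt_op T = T" "surj (sqrt_op T)"
proof -
  obtain S \<delta> where S: "positive_op S" "S o\<^sub>L S = T" "surj S" and \<delta>: "0 < \<delta>"
    and coer: "\<And>x. \<delta> * (norm x)\<^sup>2 \<le> S x \<bullet> x"
    and comm: "\<And>V. V o\<^sub>L T = T o\<^sub>L V \<Longrightarrow> V o\<^sub>L S = S o\<^sub>L V"
    by (rule coercive_square_root[OF T \<rho> coercive]) (rule that)
  have "sqrt_op T = S"
    unfolding sqrt_op_def
  proof (rule the_equality)
    fix U assume U: "positive_op U \<and> U o\<^sub>L U = T"
    have "U o\<^sub>L T = T o\<^sub>L U" using U by (auto simp: blinfun_compose_assoc)
    then have US: "U o\<^sub>L S = S o\<^sub>L U" by (rule comm)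
    show "U = S"
    proof (rule blinfun_eqI)
      fix x
      define z where "z = U x - S x"
      have "U (U x) = S (S x)" "U (S x) = S (U x)"
        using U S US by (metis blinfun_apply_blinfun_compose)+
      then have "S z + U z = 0" by (simp add: z_def blinfun.diff_right)
      then have "S z \<bullet> z + U z \<bullet> z = 0" by (metis inner_add_left inner_zero_left)
      moreover have "0 \<le> U z \<bullet> z" using U unfolding positive_op_def by blast
      ultimately have "\<delta> * (norm z)\<^sup>2 \<le> 0" using coer[of z] by linarith
      then have "z = 0" using \<delta> by (simp add: mult_le_0_iff)
      then show "U x = S x" by (simp add: z_def)
    qed
  qed (use S in blast)
  then show "positive_op (sqrt_op T)" "sqrt_op T o\<^sub>L sqrt_op T = T" "surj (sqrt_op T)"
    using S by simp_all
qed

lemma norm_sqrt_op_coercive: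
  fixes T :: "'a::{real_inner, banach} \<Rightarrow>\<^sub>L 'a"
  assumes "\<And>x z. T x \<bullet> z = x \<bullet> T z" "0 < \<rho>" "\<And>x. \<rho> * (norm x)\<^sup>2 \<le> T x \<bullet> x"
  shows "(norm (sqrt_op T x))\<^sup>2 = T x \<bullet> x"
proof -
  note S = sqrt_op_coercive[OF assms]
  have "(norm (sqrt_op T x))\<^sup>2 = sqrt_op T (sqrt_op T x) \<bullet> x"
    using S(1) by (simp add: power2_norm_eq_inner positive_op_def)
  also have "\<dots> = T x \<bullet> x"
    by (metis S(2) blinfun_apply_blinfun_compose)
  finally show ?thesis .
qed

text \<open>Duality between the two weighted norms: write m as the root applied to
  \<open>inv_sqrt_op T m\<close>, which surjectivity permits, move the root to x by symmetry, and
  apply Cauchy-Schwarz.\<close>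

lemma inner_le_norm_inv_sqrt_op:
  fixes T :: "'a::{real_inner, banach} \<Rightarrow>\<^sub>L 'a"
  assumes "\<And>x z. T x \<bullet> z = x \<bullet> T z" "0 < \<rho>" "\<And>x. \<rho> * (norm x)\<^sup>2 \<le> T x \<bullet> x"
  shows "\<bar>m \<bullet> x\<bar> \<le> norm (inv_sqrt_op T m) * sqrt (T x \<bullet> x)"
proof -
  note S = sqrt_op_coercive[OF assms]
  have "m \<bullet> x = sqrt_op T (inv_sqrt_op T m) \<bullet> x"
    by (simp add: inv_sqrt_op_def S(3) surj_f_inv_f)
  also have "\<dots> = inv_sqrt_op T m \<bullet> sqrt_op T x"
    using S(1) by (simp add: positive_op_def)
  finally have "\<bar>m \<bullet> x\<bar> \<le> norm (inv_sqrt_op T m) * norm (sqrt_op T x)"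
    by (simp add: Cauchy_Schwarz_ineq2)
  moreover have "norm (sqrt_op T x) = sqrt (T x \<bullet> x)"
    using norm_sqrt_op_coercive[OF assms, of x] by (intro real_sqrt_unique[symmetric]) auto
  ultimately show ?thesis by simp
qed

section \<open>The logistic function\<close>

lemma logistic_bounds: "0 < logistic u" "logistic u < 1"
  by (auto simp: logistic_def add_pos_pos)

lemma logistic_exp: "logistic u = exp u / (1 + exp u)"
proof -
  have "1 + exp u \<noteq> 0" "1 + exp (- u) \<noteq> 0"
    by (simp_all add: add_pos_pos less_imp_neq[symmetric])
  then show ?thesis by (simp add: logistic_def exp_minus field_simps)
qed

lemma logistic_minus: "logistic (- u) = 1 - logistic u"
proof -
  have "0 < 1 + exp u" by (simp add: add_pos_pos)
  then show ?thesis unfolding logistic_exp[of u] by (simp add: logistic_def field_simps)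
qed

lemma logistic_var_pos: "0 < logistic_var u"
  using logistic_bounds[of u] by (simp add: logistic_var_def)

lemma logistic_var_minus: "logistic_var (- u) = logistic_var u"
  by (simp add: logistic_var_def logistic_minus)

lemma logistic_increment_ge:
  assumes "0 \<le> d"
  shows "logistic_var s * d \<le> (1 + d) * (logistic (s + d) - logistic s)"
proof -
  define E where "E = exp s"
  define D where "D = exp d"
  have E: "0 < E" and D: "0 < D" "1 + d \<le> D"
    using exp_ge_add_one_self[of d] by (auto simp: E_def D_def)
  have eq: "logistic s = E / (1 + E)" "logistic (s + d) = E * D / (1 + E * D)"
    by (simp_all add: logistic_exp exp_add E_def D_def)
  have "0 < 1 + E" "0 < 1 + E * D" using E D by (auto intro: add_pos_pos)
  then have diff: "logistic (s + d) - logistic s = E * (D - 1) / ((1 + E) * (1 + E * D))"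
    and var: "logistic_var s = E / (1 + E)\<^sup>2"
    unfolding logistic_var_def eq by (auto simp: field_simps power2_eq_square)
  \<comment> \<open>After clearing denominators, the difference of the two sides is affine in E with
    coefficients (1 + d)(D - 1) - d and D - 1 - d. Both are nonnegative since D = exp d \<ge> 1 +
    d.\<close>
  have "d * 1 \<le> (D - 1) * (1 + d)"
    using D assms by (intro mult_mono) auto
  moreover have "0 \<le> E * (D - 1 - d)" using E D by simp
  ultimately have "d * (1 + E * D) \<le> (1 + d) * (D - 1) * (1 + E)"
    by (simp add: algebra_simps)
  then have "E * (d * (1 + E * D)) \<le> E * ((1 + d) * (D - 1) * (1 + E))"
    using E by (intro mult_left_mono) auto
  then have "E * (d * (1 + E * D)) / ((1 + E)\<^sup>2 * (1 + E * D))
      \<le> E * ((1 + d) * (D - 1) * (1 + E)) / ((1 + E)\<^sup>2 * (1 + E * D))"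
    using \<open>0 < 1 + E * D\<close> by (intro divide_right_mono) auto
  moreover have "E * (d * (1 + E * D)) / ((1 + E)\<^sup>2 * (1 + E * D)) = logistic_var s * d"
    using \<open>0 < 1 + E * D\<close> by (simp add: var)
  moreover have "E * ((1 + d) * (D - 1) * (1 + E)) / ((1 + E)\<^sup>2 * (1 + E * D))
      = (1 + d) * (logistic (s + d) - logistic s)"
    using \<open>0 < 1 + E\<close> by (simp add: diff power2_eq_square)
  ultimately show ?thesis by simp
qed

text \<open>The case t < s reduces to the other one by the reflection u -> -u, under which the
  variance is even. Covering both orders is what later allows the variance to be taken at the truth
  or at the estimator.\<close>

lemma self_concordance:
  "logistic_var s * (t - s)\<^sup>2 \<le> (1 + \<bar>t - s\<bar>) * ((logistic t - logistic s) * (t - s))"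
proof (cases "s \<le> t")
  case True
  then have "(t - s) * (logistic_var s * (t - s))
      \<le> (t - s) * ((1 + (t - s)) * (logistic t - logistic s))"
    using logistic_increment_ge[of "t - s" s] by (intro mult_left_mono) auto
  then show ?thesis using True by (simp add: power2_eq_square algebra_simps)
next
  case False
  then have "(s - t) * (logistic_var s * (s - t))
      \<le> (s - t) * ((1 + (s - t)) * (logistic s - logistic t))"
    using logistic_increment_ge[of "s - t" "- s"]
    by (intro mult_left_mono) (auto simp: logistic_var_minus logistic_minus)
  then show ?thesis using False by (simp add: power2_eq_square algebra_simps)
qed

lemma has_derivative_logistic_loss:
  "((\<lambda>u. logistic_loss u y) has_real_derivative logistic u - y) (at u)"
proof -
  have pos: "0 < 1 + exp (- u)" for u :: real by (simp add: add_pos_pos)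
  \<comment> \<open>In this form y enters only through a term linear in u.\<close>
  have eq: "logistic_loss u y = ln (1 + exp (- u)) + (1 - y) * u" for u
  proof -
    have "1 - logistic u = exp (- u) / (1 + exp (- u))"
      using pos[of u] by (simp add: logistic_def field_simps)
    then have "ln (1 - logistic u) = - u - ln (1 + exp (- u))"
      using pos[of u] by (simp add: ln_div)
    moreover have "ln (logistic u) = - ln (1 + exp (- u))"
      using pos[of u] by (simp add: logistic_def ln_div)
    ultimately show ?thesis
      unfolding logistic_loss_def by (simp only:) (simp add: algebra_simps)
  qed
  show ?thesis unfolding eq
    using pos[of u]
    by (auto intro!: derivative_eq_intros simp: logistic_def field_simps)
qed

lemma self_concordant_radius_bound:
  fixes N \<xi> u :: real
  assumes N: "0 \<le> N" "N \<le> \<xi>" and u: "0 \<le> u" and le: "\<xi>\<^sup>2 + N ^ 3 \<le> (1 + N) * \<xi> * u"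
  shows "N \<le> u * (1 + u)"
proof (rule ccontr)
  assume "\<not> N \<le> u * (1 + u)"
  then have N1: "u * (1 + u) < N" by simp
  \<comment> \<open>The quadratic in \<open>\<xi>\<close> is positive at \<open>N\<close>, since \<open>N > u\<close>; so its vertex \<open>(1 + N) u / 2\<close> lies
    to the right of \<open>N\<close>, which forces \<open>u > 1\<close>, and then its discriminant is negative.\<close>
  have sq: "(2 * \<xi> - (1 + N) * u)\<^sup>2 \<le> ((1 + N) * u)\<^sup>2 - 4 * N ^ 3"
    using le by (simp add: power2_eq_square algebra_simps)
  have uN: "u < N" 
  proof -
    have "0 \<le> u * u" by simp
    with N1 show ?thesis unfolding distrib_left mult.right_neutral by linarith
  qed
  have half: "2 * N < (1 + N) * u"
  proof (rule ccontr)
    assume "\<not> ?thesis"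
    \<comment> \<open>This product is the difference between the values of the quadratic at \<xi>
      and at N; the next one is its value at N.\<close>
    then have "0 \<le> (\<xi> - N) * (\<xi> + N - (1 + N) * u)"
      using N by (intro mult_nonneg_nonneg) auto
    moreover have "0 < N * ((1 + N) * (N - u))" using uN u N by (intro mult_pos_pos) auto
    ultimately show False
      using le by (simp add: power2_eq_square power3_eq_cube algebra_simps)
  qed
  then have "N * (2 - u) < u" by (simp add: algebra_simps)
  have u1: "1 < u"
  proof (rule ccontr)
    assume "\<not> 1 < u"
    then have "N * 1 \<le> N * (2 - u)" using N by (intro mult_left_mono) auto
    then show False using \<open>N * (2 - u) < u\<close> uN by linarith
  qed
  \<comment> \<open>From u + u^2 < N and u > 1. A nonnegative discriminant would then give 4 N^3
    \<le> (1 + N)^2 (N - 1) = N^3 + N^2 - N - 1, impossible for N > 1.\<close>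
  have "u\<^sup>2 \<le> N - 1" using N1 u1 by (simp add: power2_eq_square algebra_simps)
  then have "(1 + N)\<^sup>2 * u\<^sup>2 \<le> (1 + N)\<^sup>2 * (N - 1)" by (intro mult_left_mono) auto
  moreover have "4 * N ^ 3 \<le> (1 + N)\<^sup>2 * u\<^sup>2"
    using sq zero_le_power2[of "2 * \<xi> - (1 + N) * u"] unfolding power_mult_distrib by linarith
  ultimately have "4 * N ^ 3 \<le> (1 + N)\<^sup>2 * (N - 1)" by linarith
  moreover have "N ^ 2 \<le> N ^ 3" using uN u1 by (intro power_increasing) auto
  moreover have "0 \<le> N ^ 2" by simp
  moreover have "(1 + N)\<^sup>2 * (N - 1) = N ^ 3 + N ^ 2 - N - 1"
    by (simp add: power2_eq_square power3_eq_cube algebra_simps)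
  ultimately show False using N by linarith
qed

section \<open>Ridge regression error\<close>

text \<open>Arbitrary weights cover the conditional covariance and the logistic information at any
  point, so comparing these operators reduces to comparing weights.\<close>

lemma inner_regularised_weighted_sum:
  "regularised (\<Sum>j\<in>J. w j *\<^sub>R tensor_op (x j)) \<rho> v \<bullet> z
    = (\<Sum>j\<in>J. w j * ((x j \<bullet> v) * (x j \<bullet> z))) + \<rho> * (v \<bullet> z)"
  by (simp add: regularised_def blinfun.bilinear_simps blinfun.sum_left tensor_op.rep_eq
      inner_simps inner_sum_left mult.assoc)

lemma regularised_weighted_sum_symmetric:
  "regularised (\<Sum>j\<in>J. w j *\<^sub>R tensor_op (x j)) \<rho> v \<bullet> z
    = v \<bullet> regularised (\<Sum>j\<in>J. w j *\<^sub>R tensor_op (x j)) \<rho> z"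
  unfolding inner_commute[of v] inner_regularised_weighted_sum
  by (simp add: inner_commute mult.commute mult.left_commute)

lemma regularised_weighted_sum_coercive:
  assumes "\<And>j. j \<in> J \<Longrightarrow> 0 \<le> w j"
  shows "\<rho> * (norm v)\<^sup>2 \<le> regularised (\<Sum>j\<in>J. w j *\<^sub>R tensor_op (x j)) \<rho> v \<bullet> v"
  unfolding inner_regularised_weighted_sum power2_norm_eq_inner
  using assms by (simp add: sum_nonneg)

text \<open>The objective restricted to the line through f in direction h is a function of one real
  variable with a minimum at 0, so its derivative there vanishes.\<close>

lemma ridge_first_order_condition:
  fixes x :: "nat \<Rightarrow> 'a::real_inner"
  assumes "is_arg_min (\<lambda>f. (\<Sum>j\<in>J. logistic_loss (f \<bullet> x j) (Y j)) + \<rho> / 2 * (norm f)\<^sup>2) (\<lambda>_. True) f"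
  shows "(\<Sum>j\<in>J. (logistic (f \<bullet> x j) - Y j) * (h \<bullet> x j)) + \<rho> * (f \<bullet> h) = 0"
proof -
  define \<phi> where "\<phi> \<tau> = (\<Sum>j\<in>J. logistic_loss (f \<bullet> x j + \<tau> * (h \<bullet> x j)) (Y j))
    + \<rho> / 2 * (f \<bullet> f + 2 * \<tau> * (f \<bullet> h) + \<tau>\<^sup>2 * (h \<bullet> h))" for \<tau>
  have eq: "(\<Sum>j\<in>J. logistic_loss ((f + \<tau> *\<^sub>R h) \<bullet> x j) (Y j)) + \<rho> / 2 * (norm (f + \<tau> *\<^sub>R h))\<^sup>2 = \<phi> \<tau>" for \<tau>
    unfolding \<phi>_def power2_norm_eq_inner
    by (simp add: inner_simps inner_commute power2_eq_square algebra_simps)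
  have "\<phi> 0 \<le> \<phi> \<tau>" for \<tau>
    using assms unfolding eq[symmetric] by (simp add: is_arg_min_def not_less)
  moreover have "(\<phi> has_real_derivative
      (\<Sum>j\<in>J. (logistic (f \<bullet> x j) - Y j) * (h \<bullet> x j)) + \<rho> * (f \<bullet> h)) (at 0)"
    unfolding \<phi>_def
    by (rule derivative_eq_intros DERIV_sum DERIV_chain2[OF has_derivative_logistic_loss] refl | simp)+
  ultimately show ?thesis
    by (intro DERIV_local_min[of \<phi> _ 0 1]) auto
qed

lemma ridge_error_identity:
  fixes x :: "nat \<Rightarrow> 'a::real_inner" and f g :: 'a
  assumes "is_arg_min (\<lambda>f. (\<Sum>j\<in>J. logistic_loss (f \<bullet> x j) (Y j)) + \<rho> / 2 * (norm f)\<^sup>2) (\<lambda>_. True) f"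
  shows "(\<Sum>j\<in>J. (logistic (g \<bullet> x j) - logistic (f \<bullet> x j)) * ((g - f) \<bullet> x j)) + \<rho> * (norm (g - f))\<^sup>2
    = \<rho> * (g \<bullet> (g - f)) - (\<Sum>j\<in>J. (Y j - logistic (g \<bullet> x j)) *\<^sub>R x j) \<bullet> (g - f)"
proof -
  define h where "h = g - f"
  have "(\<Sum>j\<in>J. (logistic (g \<bullet> x j) - logistic (f \<bullet> x j)) * (h \<bullet> x j))
    = (\<Sum>j\<in>J. - (((Y j - logistic (g \<bullet> x j)) *\<^sub>R x j) \<bullet> h)
        - (logistic (f \<bullet> x j) - Y j) * (h \<bullet> x j))"
    by (intro sum.cong) (simp_all add: inner_commute[of h] algebra_simps)
  also have "\<dots> = - ((\<Sum>j\<in>J. (Y j - logistic (g \<bullet> x j)) *\<^sub>R x j) \<bullet> h)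
      - (\<Sum>j\<in>J. (logistic (f \<bullet> x j) - Y j) * (h \<bullet> x j))"
    by (simp only: sum_subtractf sum_negf inner_sum_left)
  finally have "(\<Sum>j\<in>J. (logistic (g \<bullet> x j) - logistic (f \<bullet> x j)) * (h \<bullet> x j))
    = - ((\<Sum>j\<in>J. (Y j - logistic (g \<bullet> x j)) *\<^sub>R x j) \<bullet> h)
      - (\<Sum>j\<in>J. (logistic (f \<bullet> x j) - Y j) * (h \<bullet> x j))" .
  moreover have "\<rho> * (norm h)\<^sup>2 = \<rho> * (g \<bullet> h) - \<rho> * (f \<bullet> h)"
    unfolding power2_norm_eq_inner by (simp add: h_def inner_simps algebra_simps)
  ultimately show ?thesis
    using ridge_first_order_condition[OF assms, of h] unfolding h_def[symmetric] by simp
qed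

text \<open>The deterministic core, for a single outcome: g is the truth, f the minimiser, and w
  stands for the conditional variances of the residuals. The last two bounds keep the factor 1 +
  \<open>norm (g - f)\<close>, into which the first bound is inserted later.\<close>

lemma logistic_ridge_error:
  fixes x :: "nat \<Rightarrow> 'a::{real_inner, banach}" and f g :: 'a
  assumes f: "is_arg_min (\<lambda>f. (\<Sum>j\<in>J. logistic_loss (f \<bullet> x j) (Y j)) + \<rho> / 2 * (norm f)\<^sup>2) (\<lambda>_. True) f"
    and \<rho>: "0 < \<rho>" and x: "\<And>j. j \<in> J \<Longrightarrow> norm (x j) \<le> 1" and g: "norm g \<le> b"
    and w: "\<And>j. j \<in> J \<Longrightarrow> 0 \<le> w j" "\<And>j. j \<in> J \<Longrightarrow> w j \<le> logistic_var (g \<bullet> x j)"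
    and \<beta>: "norm (inv_sqrt_op (regularised (\<Sum>j\<in>J. w j *\<^sub>R tensor_op (x j)) \<rho>)
        (\<Sum>j\<in>J. (Y j - logistic (g \<bullet> x j)) *\<^sub>R x j)) \<le> \<beta>"
  defines "u \<equiv> \<beta> / sqrt \<rho> + b"
    and "H \<equiv> \<lambda>k. regularised (\<Sum>j\<in>J. logistic_var (k \<bullet> x j) *\<^sub>R tensor_op (x j)) \<rho>"
  shows "norm (g - f) \<le> u * (1 + u)"
    and "norm (sqrt_op (H g) (g - f)) \<le> u * (1 + norm (g - f)) * sqrt \<rho>"
    and "norm (sqrt_op (H f) (g - f)) \<le> u * (1 + norm (g - f)) * sqrt \<rho>"
proof -
  define h where "h = g - f"
  define N where "N = norm h"
  define Q where "Q = regularised (\<Sum>j\<in>J. w j *\<^sub>R tensor_op (x j)) \<rho>"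
  define m where "m = (\<Sum>j\<in>J. (Y j - logistic (g \<bullet> x j)) *\<^sub>R x j)"
  define z where "z j = h \<bullet> x j" for j
  define G where "G = (\<Sum>j\<in>J. (logistic (g \<bullet> x j) - logistic (f \<bullet> x j)) * z j)"
  define a where "a k = norm (sqrt_op (H k) h)" for k
  have N: "0 \<le> N" by (simp add: N_def)
  have \<beta>0: "0 \<le> \<beta>" using \<beta> norm_ge_zero order_trans by blast
  have b0: "0 \<le> b" using g norm_ge_zero order_trans by blast
  have u0: "0 \<le> u" using \<beta>0 b0 \<rho> by (simp add: u_def)
  have usq: "u * sqrt \<rho> = \<beta> + b * sqrt \<rho>" using \<rho> by (simp add: u_def field_simps)
  have a2: "(a k)\<^sup>2 = (\<Sum>j\<in>J. logistic_var (k \<bullet> x j) * (z j)\<^sup>2) + \<rho> * N\<^sup>2" for k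
  proof -
    have "(a k)\<^sup>2 = H k h \<bullet> h"
      unfolding a_def H_def
      by (rule norm_sqrt_op_coercive[OF regularised_weighted_sum_symmetric \<rho>
            regularised_weighted_sum_coercive]) (rule less_imp_le[OF logistic_var_pos])
    then show ?thesis
      unfolding H_def inner_regularised_weighted_sum
      by (simp add: z_def inner_commute power2_eq_square N_def flip: power2_norm_eq_inner)
  qed
  have zN: "\<bar>z j\<bar> \<le> N" if "j \<in> J" for j
  proof -
    have "\<bar>z j\<bar> \<le> norm h * norm (x j)" unfolding z_def by (rule Cauchy_Schwarz_ineq2)
    also have "\<dots> \<le> norm h * 1" using x[OF that] by (intro mult_left_mono) auto
    finally show ?thesis by (simp add: N_def)
  qed
  have st: "g \<bullet> x j - f \<bullet> x j = z j" for j by (simp add: z_def h_def inner_diff_left)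
  have sc: "logistic_var (k \<bullet> x j) * (z j)\<^sup>2
      \<le> (1 + N) * ((logistic (g \<bullet> x j) - logistic (f \<bullet> x j)) * z j)"
    if j: "j \<in> J" and k: "k = g \<or> k = f" for j k
  proof -
    have le: "logistic_var (k \<bullet> x j) * (z j)\<^sup>2
        \<le> (1 + \<bar>z j\<bar>) * ((logistic (g \<bullet> x j) - logistic (f \<bullet> x j)) * z j)"
    proof (cases "k = f")
      case True
      then show ?thesis using self_concordance[of "f \<bullet> x j" "g \<bullet> x j"] by (simp only: st)
    next
      case False
      have ts: "f \<bullet> x j - g \<bullet> x j = - z j" by (simp flip: st)
      have "(logistic (f \<bullet> x j) - logistic (g \<bullet> x j)) * - z j
          = (logistic (g \<bullet> x j) - logistic (f \<bullet> x j)) * z j"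
        by (simp add: left_diff_distrib)
      then show ?thesis
        using False k self_concordance[of "g \<bullet> x j" "f \<bullet> x j"] unfolding ts by simp
    qed
    have "0 \<le> logistic_var (k \<bullet> x j) * (z j)\<^sup>2"
      using logistic_var_pos[of "k \<bullet> x j"] by simp
    \<comment> \<open>Self-concordance itself shows that the increment product is nonnegative, so
      \<bar>z j\<bar> may be enlarged to N.\<close>
    with le have "(1 + \<bar>z j\<bar>) * 0 \<le> (1 + \<bar>z j\<bar>) * ((logistic (g \<bullet> x j) - logistic (f \<bullet> x j)) * z j)"
      by linarith
    then have "0 \<le> (logistic (g \<bullet> x j) - logistic (f \<bullet> x j)) * z j"
      by (rule mult_left_le_imp_le) (simp add: add_pos_nonneg)
    then have "(1 + \<bar>z j\<bar>) * ((logistic (g \<bullet> x j) - logistic (f \<bullet> x j)) * z j)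
        \<le> (1 + N) * ((logistic (g \<bullet> x j) - logistic (f \<bullet> x j)) * z j)"
      using zN[OF j] by (intro mult_right_mono) auto
    with le show ?thesis by linarith
  qed
  have aG: "(a k)\<^sup>2 \<le> (1 + N) * G + \<rho> * N\<^sup>2" if "k = g \<or> k = f" for k
    unfolding a2 G_def sum_distrib_left using sc that by (intro add_right_mono sum_mono) auto
  have a0: "0 \<le> a k" for k by (simp add: a_def)
  have Na: "N * sqrt \<rho> \<le> a k" for k
  proof (rule power2_le_imp_le)
    show "(N * sqrt \<rho>)\<^sup>2 \<le> (a k)\<^sup>2"
      unfolding a2 using \<rho>
      by (simp add: power_mult_distrib mult.commute sum_nonneg less_imp_le[OF logistic_var_pos])
  qed (rule a0)
  have "G + \<rho> * N\<^sup>2 = \<rho> * (g \<bullet> h) - m \<bullet> h"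
    using ridge_error_identity[OF f, of g] unfolding G_def z_def N_def m_def h_def .
  \<comment> \<open>The ridge bias is absorbed using N sqrt \<rho> \<le> a g. The noise term is
    bounded by duality with respect to Q, whose quadratic form is at most (a g)^2 because w is
    dominated by the variances at g.\<close>
  also have "\<dots> \<le> sqrt \<rho> * b * a g + \<beta> * a g"
  proof -
    have "g \<bullet> h \<le> norm g * norm h" by (rule norm_cauchy_schwarz)
    also have "\<dots> \<le> b * N" unfolding N_def using g by (intro mult_right_mono) auto
    finally have "\<rho> * (g \<bullet> h) \<le> (sqrt \<rho> * sqrt \<rho>) * (b * N)" using \<rho> by simp
    also have "\<dots> = (sqrt \<rho> * b) * (N * sqrt \<rho>)" by simp
    also have "\<dots> \<le> (sqrt \<rho> * b) * a g"
      using \<rho> b0 Na by (intro mult_left_mono) auto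
    finally have 1: "\<rho> * (g \<bullet> h) \<le> sqrt \<rho> * b * a g" .
    have "\<bar>m \<bullet> h\<bar> \<le> norm (inv_sqrt_op Q m) * sqrt (Q h \<bullet> h)"
      unfolding Q_def
      by (rule inner_le_norm_inv_sqrt_op[OF regularised_weighted_sum_symmetric \<rho>
            regularised_weighted_sum_coercive]) (rule w(1))
    also have "\<dots> \<le> \<beta> * a g"
    proof (rule mult_mono)
      show "norm (inv_sqrt_op Q m) \<le> \<beta>" using \<beta> by (simp add: Q_def m_def)
      have "Q h \<bullet> h \<le> (a g)\<^sup>2"
        unfolding a2 Q_def inner_regularised_weighted_sum
        using w(2) by (auto simp: z_def N_def power2_eq_square inner_commute simp flip: power2_norm_eq_inner
            intro!: sum_mono mult_right_mono)
      then show "sqrt (Q h \<bullet> h) \<le> a g" using a0 by (simp add: real_le_lsqrt real_sqrt_le_iff)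
      show "0 \<le> sqrt (Q h \<bullet> h)"
        unfolding Q_def using \<rho> w(1) regularised_weighted_sum_coercive[of J w \<rho> h x]
        by (smt (verit) mult_nonneg_nonneg real_sqrt_ge_zero zero_le_power2)
    qed (rule \<beta>0)
    finally show ?thesis using 1 by linarith
  qed
  also have "\<dots> = u * sqrt \<rho> * a g" unfolding usq by (simp add: algebra_simps)
  finally have main: "G + \<rho> * N\<^sup>2 \<le> u * sqrt \<rho> * a g" .
  \<comment> \<open>Multiplying the ridge term by 1 + N leaves a surplus \<rho> N^3 beyond what
    \<open>aG\<close> uses. The right-hand side involves \<open>a g\<close> for both choices of
    k.\<close>
  have refined: "(a k)\<^sup>2 + \<rho> * N ^ 3 \<le> (1 + N) * (u * sqrt \<rho> * a g)" if "k = g \<or> k = f" for k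
  proof -
    have "(a k)\<^sup>2 + \<rho> * N ^ 3 \<le> (1 + N) * (G + \<rho> * N\<^sup>2)"
      using aG[OF that] by (simp add: power2_eq_square power3_eq_cube algebra_simps)
    also have "\<dots> \<le> (1 + N) * (u * sqrt \<rho> * a g)"
      using main N by (intro mult_left_mono) auto
    finally show ?thesis .
  qed
  define \<xi> where "\<xi> = a g / sqrt \<rho>"
  have ag: "a g = \<xi> * sqrt \<rho>" using \<rho> by (simp add: \<xi>_def)
  have "(\<xi>\<^sup>2 + N ^ 3) * \<rho> \<le> (1 + N) * \<xi> * u * \<rho>"
    using refined[of g] \<rho> unfolding ag
    by (simp add: power_mult_distrib algebra_simps)
  then have "\<xi>\<^sup>2 + N ^ 3 \<le> (1 + N) * \<xi> * u" using \<rho> by simp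
  moreover have "N \<le> \<xi>" using Na[of g] \<rho> by (simp add: \<xi>_def field_simps)
  ultimately show "norm (g - f) \<le> u * (1 + u)"
    using self_concordant_radius_bound[OF N _ u0] by (simp add: N_def h_def)
  have cube: "0 \<le> \<rho> * N ^ 3" using \<rho> N by simp
  have agle: "a g \<le> u * (1 + N) * sqrt \<rho>"
  proof (cases "a g = 0")
    case False
    then have "0 < a g" using a0[of g] by simp
    moreover have "a g * a g \<le> (u * (1 + N) * sqrt \<rho>) * a g"
      using refined[of g] cube by (simp add: power2_eq_square algebra_simps)
    ultimately show ?thesis by simp
  qed (use u0 N \<rho> in simp)
  then show "norm (sqrt_op (H g) (g - f)) \<le> u * (1 + norm (g - f)) * sqrt \<rho>"
    by (simp add: a_def N_def h_def)
  \<comment> \<open>For k = f there is no factor to cancel; the bound just proved for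
    \<open>a g\<close> is inserted instead.\<close>
  have "a f \<le> u * (1 + N) * sqrt \<rho>"
  proof (rule power2_le_imp_le)
    have "(a f)\<^sup>2 \<le> (u * (1 + N) * sqrt \<rho>) * a g"
      using refined[of f] cube by (simp add: algebra_simps)
    also have "\<dots> \<le> (u * (1 + N) * sqrt \<rho>) * (u * (1 + N) * sqrt \<rho>)"
      using agle u0 N \<rho> by (intro mult_left_mono) auto
    finally show "(a f)\<^sup>2 \<le> (u * (1 + N) * sqrt \<rho>)\<^sup>2" by (simp add: power2_eq_square)
  qed (use u0 N \<rho> in simp)
  then show "norm (sqrt_op (H f) (g - f)) \<le> u * (1 + norm (g - f)) * sqrt \<rho>"
    by (simp add: a_def N_def h_def)
qed

section \<open>Conditional variance of the residuals\<close>

lemma (in adaptive_logistic_model) residual_cond_variance_bounds: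
  assumes n: "n \<ge> 1"
  shows "AE \<omega> in M. 0 \<le> real_cond_exp M (F (n - 1)) (\<lambda>\<omega>'. (residual X Y fstar n \<omega>')\<^sup>2) \<omega> \<and>
    real_cond_exp M (F (n - 1)) (\<lambda>\<omega>'. (residual X Y fstar n \<omega>')\<^sup>2) \<omega>
      \<le> logistic_var (fstar \<bullet> X n \<omega>)"
proof -
  interpret S: finite_measure_subalgebra M "F (n - 1)"
    by unfold_locales (rule filtration_subalgebra)
  let ?E = "real_cond_exp M (F (n - 1))"
  let ?p = "\<lambda>\<omega>. logistic (fstar \<bullet> X n \<omega>)"
  have [measurable]: "X n \<in> borel_measurable (F (n - 1))" using X_predictable[OF n] .
  have pF[measurable]: "?p \<in> borel_measurable (F (n - 1))"
    unfolding logistic_def by measurable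
  have [measurable]: "?p \<in> borel_measurable M" "Y n \<in> borel_measurable M"
    using pF Y_adapted[OF n] filtration_subalgebra measurable_from_subalg by blast+
  have Y: "0 \<le> Y n \<omega>" "Y n \<omega> \<le> 1" if "\<omega> \<in> space M" for \<omega>
    using Y_range[OF n that] by auto
  have p: "0 < ?p \<omega>" "?p \<omega> < 1" for \<omega> by (rule logistic_bounds)+
  have pabs: "\<bar>?p \<omega>\<bar> \<le> 1" for \<omega> using p[of \<omega>] by linarith
  have intp: "integrable M ?p" and intp2: "integrable M (\<lambda>\<omega>. (?p \<omega>)\<^sup>2)"
    and intY: "integrable M (Y n)" and intpY: "integrable M (\<lambda>\<omega>. (1 - 2 * ?p \<omega>) * Y n \<omega>)"
    and intr: "integrable M (\<lambda>\<omega>. (residual X Y fstar n \<omega>)\<^sup>2)"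
  proof -
    note bound = integrable_const_bound[where B = 1]
    show "integrable M ?p" using pabs by (intro bound) (auto intro!: AE_I2)
    show "integrable M (\<lambda>\<omega>. (?p \<omega>)\<^sup>2)"
      using pabs by (intro bound) (auto intro!: AE_I2 simp: abs_square_le_1)
    show "integrable M (Y n)" using Y by (intro bound) (auto intro!: AE_I2)
    show "integrable M (\<lambda>\<omega>. (1 - 2 * ?p \<omega>) * Y n \<omega>)"
    proof (intro bound AE_I2)
      fix \<omega> assume "\<omega> \<in> space M"
      then show "norm ((1 - 2 * ?p \<omega>) * Y n \<omega>) \<le> 1"
        using Y p[of \<omega>] by (auto simp: abs_mult intro!: mult_le_one)
    qed measurable
    show "integrable M (\<lambda>\<omega>. (residual X Y fstar n \<omega>)\<^sup>2)"
    proof (intro bound AE_I2)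
      fix \<omega> assume "\<omega> \<in> space M"
      then have "\<bar>residual X Y fstar n \<omega>\<bar> \<le> 1"
        using Y[of \<omega>] p[of \<omega>] unfolding residual_def by linarith
      then show "norm ((residual X Y fstar n \<omega>)\<^sup>2) \<le> 1" by (simp add: abs_square_le_1)
    qed (simp add: residual_def)
  qed
  have "AE \<omega> in M. 0 \<le> ?E (\<lambda>\<omega>'. (residual X Y fstar n \<omega>')\<^sup>2) \<omega>"
    using intr by (intro S.real_cond_exp_pos) auto
  \<comment> \<open>Since Y^2 \<le> Y on [0, 1], the squared residual is at most (1 - 2p) Y + p^2,
    with equality for Bernoulli responses. This is affine in Y, and its conditional expectation is
    (1 - 2p) p + p^2 = p (1 - p).\<close>
  moreover have "AE \<omega> in M. ?E (\<lambda>\<omega>'. (residual X Y fstar n \<omega>')\<^sup>2) \<omega>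
      \<le> ?E (\<lambda>\<omega>'. (1 - 2 * ?p \<omega>') * Y n \<omega>' + (?p \<omega>')\<^sup>2) \<omega>"
  proof (intro S.real_cond_exp_mono AE_I2)
    fix \<omega> assume "\<omega> \<in> space M"
    then have "Y n \<omega> * Y n \<omega> \<le> Y n \<omega>" using Y by (intro mult_left_le) auto
    then show "(residual X Y fstar n \<omega>)\<^sup>2 \<le> (1 - 2 * ?p \<omega>) * Y n \<omega> + (?p \<omega>)\<^sup>2"
      by (simp add: residual_def power2_eq_square algebra_simps)
  qed (use intr intpY intp2 in auto)
  moreover have "AE \<omega> in M. ?E (\<lambda>\<omega>'. (1 - 2 * ?p \<omega>') * Y n \<omega>' + (?p \<omega>')\<^sup>2) \<omega>
      = ?E (\<lambda>\<omega>'. (1 - 2 * ?p \<omega>') * Y n \<omega>') \<omega> + ?E (\<lambda>\<omega>'. (?p \<omega>')\<^sup>2) \<omega>"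
    using intpY intp2 by (rule S.real_cond_exp_add)
  moreover have "AE \<omega> in M. ?E (\<lambda>\<omega>'. (1 - 2 * ?p \<omega>') * Y n \<omega>') \<omega> = (1 - 2 * ?p \<omega>) * ?E (Y n) \<omega>"
    by (rule S.real_cond_exp_mult[OF _ _ intpY]; measurable)
  moreover have "AE \<omega> in M. ?E (\<lambda>\<omega>'. (?p \<omega>')\<^sup>2) \<omega> = (?p \<omega>)\<^sup>2"
    by (rule S.real_cond_exp_F_meas[OF intp2]; measurable)
  moreover note Y_cond_mean[OF n]
  ultimately show ?thesis
  proof eventually_elim
    case (elim \<omega>)
    have "(1 - 2 * ?p \<omega>) * ?p \<omega> + (?p \<omega>)\<^sup>2 = logistic_var (fstar \<bullet> X n \<omega>)"
      by (simp add: logistic_var_def power2_eq_square algebra_simps)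
    with elim show ?case by simp
  qed
qed

theorem mainTheorem3:
  fixes M :: "'w measure" and F :: "nat \<Rightarrow> 'w measure"
    and \<X> :: "'a::{real_inner, banach, second_countable_topology} set"
    and X :: "nat \<Rightarrow> 'w \<Rightarrow> 'a" and Y :: "nat \<Rightarrow> 'w \<Rightarrow> real"
    and fstar :: 'a and b \<rho> y K :: real
    and \<beta> :: "nat \<Rightarrow> real \<Rightarrow> real \<Rightarrow> 'w \<Rightarrow> real"
    and fhat :: "nat \<Rightarrow> 'w \<Rightarrow> 'a"
  assumes model: "adaptive_logistic_model M F \<X> X Y fstar b"
    and y_pos: "0 < y" and rho_pos: "0 < \<rho>"
    and radius: "concentration_radius M F X Y fstar K \<beta> \<rho> y"
    and fhat: "\<And>n \<omega>. n \<ge> 1 \<Longrightarrow> \<omega> \<in> space M \<Longrightarrow>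
      is_arg_min (regularised_loss X Y \<rho> n \<omega>) (\<lambda>_. True) (fhat n \<omega>)"
  defines "u \<equiv> \<lambda>n \<omega>. \<beta> n \<rho> y \<omega> / sqrt \<rho> + b"
  defines "om \<equiv> \<lambda>n \<omega>. u n \<omega> * (6 + 2 * (u n \<omega>) ^ 3) * sqrt \<rho>"
  defines "\<alpha> \<equiv> \<lambda>n \<omega>. u n \<omega> * (1 + u n \<omega>)"
  shows "AE \<omega> in M. \<omega> \<in> concentration_event M F X Y fstar \<beta> \<rho> y \<longrightarrow>
    (\<forall>n\<ge>1.
      max (norm (sqrt_op (regularised (logistic_info X n fstar \<omega>) \<rho>) (fstar - fhat n \<omega>)))
          (norm (sqrt_op (regularised (logistic_info X n (fhat n \<omega>) \<omega>) \<rho>) (fstar - fhat n \<omega>)))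
        \<le> om n \<omega> \<and>
      norm (fstar - fhat n \<omega>) \<le> \<alpha> n \<omega>)"
proof -
  interpret adaptive_logistic_model M F \<X> X Y fstar b by (rule model)
  define W where "W j \<omega> = real_cond_exp M (F (j - 1)) (\<lambda>\<omega>'. (residual X Y fstar j \<omega>')\<^sup>2) \<omega>" for j \<omega>
  \<comment> \<open>Countably many null sets are merged, so one exceptional set serves all
    n.\<close>
  have "AE \<omega> in M. \<forall>j. j \<ge> 1 \<longrightarrow> 0 \<le> W j \<omega> \<and> W j \<omega> \<le> logistic_var (fstar \<bullet> X j \<omega>)"
    unfolding W_def AE_all_countable
    using residual_cond_variance_bounds by (auto intro: AE_impI)
  with AE_space show ?thesis
  proof eventually_elim
    case (elim \<omega>)
    show ?case
    proof (intro impI allI)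
      fix n :: nat assume C: "\<omega> \<in> concentration_event M F X Y fstar \<beta> \<rho> y" and n: "n \<ge> 1"
      let ?f = "fhat n \<omega>" and ?u = "u n \<omega>"
      have norm_X: "norm (X j \<omega>) \<le> 1" if "j \<in> {1..n}" for j
        using X_range[of j \<omega>] that elim(1) covariate_set_subset by auto
      have radius_n: "norm (inv_sqrt_op (regularised (\<Sum>j\<in>{1..n}. W j \<omega> *\<^sub>R tensor_op (X j \<omega>)) \<rho>)
          (\<Sum>j\<in>{1..n}. (Y j \<omega> - logistic (fstar \<bullet> X j \<omega>)) *\<^sub>R X j \<omega>)) \<le> \<beta> n \<rho> y \<omega>"
        using C n by (auto simp: concentration_event_def cond_covariance_def residual_sum_def
            residual_def W_def)
      have opt: "is_arg_min (\<lambda>f. (\<Sum>j\<in>{1..n}. logistic_loss (f \<bullet> X j \<omega>) (Y j \<omega>))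
          + \<rho> / 2 * (norm f)\<^sup>2) (\<lambda>_. True) ?f"
        using fhat[OF n elim(1)] unfolding regularised_loss_def[abs_def] .
      have W: "0 \<le> W j \<omega>" "W j \<omega> \<le> logistic_var (fstar \<bullet> X j \<omega>)" if "j \<in> {1..n}" for j
        using elim(2) that by auto
      have error: "norm (fstar - ?f) \<le> ?u * (1 + ?u)"
        "norm (sqrt_op (regularised (logistic_info X n fstar \<omega>) \<rho>) (fstar - ?f))
          \<le> ?u * (1 + norm (fstar - ?f)) * sqrt \<rho>"
        "norm (sqrt_op (regularised (logistic_info X n ?f \<omega>) \<rho>) (fstar - ?f))
          \<le> ?u * (1 + norm (fstar - ?f)) * sqrt \<rho>"
        unfolding logistic_info_def u_def
        by (rule logistic_ridge_error[OF opt rho_pos norm_X fstar_bound W radius_n]; assumption)+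
      have u0: "0 \<le> ?u"
        using radius n elim(1) rho_pos b_pos by (auto simp: u_def concentration_radius_def)
      \<comment> \<open>For u \<le> 1 the left side is at most 3; for u > 1 both u and u^2 are at
        most u^3.\<close>
      have "1 + ?u * (1 + ?u) \<le> 6 + 2 * ?u ^ 3"
      proof (cases "?u \<le> 1")
        case True
        then have "?u * (1 + ?u) \<le> 1 * 2" using u0 by (intro mult_mono) auto
        moreover have "0 \<le> ?u ^ 3" using u0 by simp
        ultimately show ?thesis by linarith
      next
        case False
        then have "?u ^ 1 \<le> ?u ^ 3" "?u ^ 2 \<le> ?u ^ 3" by (intro power_increasing; simp)+
        then show ?thesis by (simp add: power2_eq_square distrib_left)
      qed
      then have "1 + norm (fstar - ?f) \<le> 6 + 2 * ?u ^ 3"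
        using error(1) by linarith
      then have "?u * (1 + norm (fstar - ?f)) * sqrt \<rho> \<le> om n \<omega>"
        unfolding om_def using u0 rho_pos by (intro mult_right_mono mult_left_mono) auto
      then show "max (norm (sqrt_op (regularised (logistic_info X n fstar \<omega>) \<rho>) (fstar - ?f)))
          (norm (sqrt_op (regularised (logistic_info X n ?f \<omega>) \<rho>) (fstar - ?f))) \<le> om n \<omega> \<and>
        norm (fstar - ?f) \<le> \<alpha> n \<omega>"
        using error unfolding \<alpha>_def by (intro conjI max.boundedI) linarith+
    qed
  qed
qed

end
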